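(* Let $h\colon\mathbb{R}^n\to\mathbb{R}\cup\{+\infty\}$ be a Legendre function with $0\in\operatorname{int}\operatorname{dom}h$ and $\nabla h(0)=0$. Let $K=\operatorname{cone}(B_K)\subset\mathbb{R}^n$ be a polyhedral cone with normalized conic base $B_K=\{u^1,\ldots,u^p\}$, and assume $\operatorname{aff}(B_K)\subset\operatorname{int}\operatorname{dom}h$ and $0\notin\operatorname{aff}(B_K)$. Suppose the minimizer $$c_h:=\operatorname*{arg\,min}_{x\in\operatorname{aff}(B_K)}D_h(x,0)$$ exists (it is then unique), and set $\kappa_h:=\langle\nabla h(c_h),c_h\rangle$. Then $c_h\ne0$, $\kappa_h>0$, and $$\langle\nabla h(c_h),u^i\rangle=\kappa_h,\qquad i=1,\ldots,p.$$
   Context: $\langle\cdot,\cdot\rangle$ and $\|\cdot\|$ are the Euclidean inner product and norm. A Legendre function (in the sense of Rockafellar) is a proper, lower semicontinuous, convex function that is essentially smooth and essentially strictly convex, with $\operatorname{int}\operatorname{dom}h\ne\emptyset$. The Bregman divergence is $D_h(x,y):=h(x)-h(y)-\langle\nabla h(y),x-y\rangle$ for $x\in\operatorname{dom}h$, $y\in\operatorname{int}\operatorname{dom}h$. The normalized conic base $B_K$ of a polyhedral cone $K$ is the finite set of unit vectors along its extreme rays; $\operatorname{aff}$ denotes affine hull. *)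

theory Defs
  imports "HOL-Analysis.Analysis"
begin

text \<open>Functions into the reals with a point at plus infinity are modelled as
  \<^typ>\<open>ereal\<close>-valued functions; \<open>proper\<close> excludes the value minus infinity.\<close>

definition edom :: "('a \<Rightarrow> ereal) \<Rightarrow> 'a set" where
  "edom h = {x. h x < \<infinity>}"

definition proper :: "('a \<Rightarrow> ereal) \<Rightarrow> bool" where
  "proper h \<longleftrightarrow> (\<forall>x. h x \<noteq> -\<infinity>) \<and> edom h \<noteq> {}"

definition lsc :: "('a::euclidean_space \<Rightarrow> ereal) \<Rightarrow> bool" where
  "lsc h \<longleftrightarrow> (\<forall>x. h x \<le> Liminf (at x) h)"

definition epigraph :: "('a \<Rightarrow> ereal) \<Rightarrow> ('a \<times> real) set" where
  "epigraph h = {(x, r). h x \<le> ereal r}"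

definition convex_fun :: "('a::euclidean_space \<Rightarrow> ereal) \<Rightarrow> bool" where
  "convex_fun h \<longleftrightarrow> convex (epigraph h)"

text \<open>As \<open>real_of_ereal \<infinity> = 0\<close>, differentiability and the gradient are meaningful only at
  interior points of \<open>edom h\<close>, and are only used there.\<close>

definition grad :: "('a::euclidean_space \<Rightarrow> ereal) \<Rightarrow> 'a \<Rightarrow> 'a" where
  "grad h x = (THE v. GDERIV (\<lambda>z. real_of_ereal (h z)) x :> v)"

definition essentially_smooth :: "('a::euclidean_space \<Rightarrow> ereal) \<Rightarrow> bool" where
  "essentially_smooth h \<longleftrightarrow>
     interior (edom h) \<noteq> {} \<and>
     (\<forall>x \<in> interior (edom h). (\<lambda>z. real_of_ereal (h z)) differentiable (at x)) \<and>
     (\<forall>X x. (\<forall>i::nat. X i \<in> interior (edom h)) \<longrightarrow> X \<longlonglongrightarrow> x \<longrightarrow>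
        x \<in> frontier (interior (edom h)) \<longrightarrow>
        filterlim (\<lambda>i. norm (grad h (X i))) at_top sequentially)"

definition subdifferential :: "('a::euclidean_space \<Rightarrow> ereal) \<Rightarrow> 'a \<Rightarrow> 'a set" where
  "subdifferential h x = {v. \<forall>z. h z \<ge> h x + ereal (v \<bullet> (z - x))}"

definition strictly_convex_fun_on :: "'a::euclidean_space set \<Rightarrow> ('a \<Rightarrow> ereal) \<Rightarrow> bool" where
  "strictly_convex_fun_on C h \<longleftrightarrow>
     (\<forall>x\<in>C. \<forall>y\<in>C. \<forall>t. x \<noteq> y \<longrightarrow> 0 < t \<longrightarrow> t < 1 \<longrightarrow>
        h ((1 - t) *\<^sub>R x + t *\<^sub>R y) < ereal (1 - t) * h x + ereal t * h y)"

definition essentially_strictly_convex :: "('a::euclidean_space \<Rightarrow> ereal) \<Rightarrow> bool" where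
  "essentially_strictly_convex h \<longleftrightarrow>
     (\<forall>C. convex C \<longrightarrow> C \<subseteq> {x. subdifferential h x \<noteq> {}} \<longrightarrow> strictly_convex_fun_on C h)"

definition legendre :: "('a::euclidean_space \<Rightarrow> ereal) \<Rightarrow> bool" where
  "legendre h \<longleftrightarrow>
     proper h \<and> lsc h \<and> convex_fun h \<and>
     essentially_smooth h \<and> essentially_strictly_convex h \<and>
     interior (edom h) \<noteq> {}"

text \<open>Meant for \<open>x \<in> edom h\<close> and \<open>y \<in> interior (edom h)\<close>.\<close>

definition bregman :: "('a::euclidean_space \<Rightarrow> ereal) \<Rightarrow> 'a \<Rightarrow> 'a \<Rightarrow> ereal" where
  "bregman h x y = h x - h y - ereal (grad h y \<bullet> (x - y))"

definition polyhedral_cone :: "'a::euclidean_space set \<Rightarrow> bool" where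
  "polyhedral_cone K \<longleftrightarrow> polyhedron K \<and> convex_cone K"

text \<open>An extreme ray is a face that is a half-line emanating from the origin; for a unit vector
  \<open>u\<close>, the set \<open>conic hull {u}\<close> is the half-line \<open>{t *\<^sub>R u | t. t \<ge> 0}\<close>.\<close>

definition normalized_conic_base :: "'a::euclidean_space set \<Rightarrow> 'a set" where
  "normalized_conic_base K = {u. norm u = 1 \<and> (conic hull {u}) face_of K}"

end

theory Submission
  imports Defs
begin

text \<open>Since \<open>\<nabla>h(0) = 0\<close>, the divergence \<open>D\<^sub>h(x, 0)\<close> is \<open>h(x) - h(0)\<close>, so \<open>c\<close> minimizes \<open>h\<close> over an
  affine set on which \<open>h\<close> is differentiable. Stationarity along the lines through \<open>c\<close> makes
  \<open>\<nabla>h(c)\<close> constant on this set. Interior points of the domain have the gradient as a subgradient,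
  so \<open>h\<close> is strictly convex there; hence the minimizer is unique, \<open>0\<close> is the strict global minimizer
  of \<open>h\<close>, and \<open>\<kappa> \<ge> h(c) - h(0) > 0\<close> by the subgradient inequality at \<open>c\<close>.\<close>

lemma GDERIV_unique:
  fixes f :: "'a::euclidean_space \<Rightarrow> real"
  assumes "GDERIV f x :> v" "GDERIV f x :> w"
  shows "v = w"
proof -
  have "(\<lambda>y. y \<bullet> v) = (\<lambda>y. y \<bullet> w)"
    using assms has_derivative_unique unfolding gderiv_def by blast
  then have "y \<bullet> v = y \<bullet> w" for y by metis
  then show ?thesis
    by (metis inner_commute vector_eq_ldot)
qed

text \<open>Riesz representation: the derivative is a linear functional, represented by the vector
  \<open>adjoint f' 1\<close>.\<close>

lemma differentiable_imp_GDERIV: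
  fixes f :: "'a::euclidean_space \<Rightarrow> real"
  assumes "f differentiable (at x)"
  shows "\<exists>v. GDERIV f x :> v"
proof -
  obtain f' where f': "(f has_derivative f') (at x)"
    using assms by (auto simp: differentiable_def)
  then have "linear f'"
    by (rule has_derivative_linear)
  then have "f' y = y \<bullet> adjoint f' 1" for y
    using adjoint_works[of f' y 1] by simp
  then have "f' = (\<lambda>y. y \<bullet> adjoint f' 1)"
    by (rule ext)
  then show ?thesis
    using f' unfolding gderiv_def by metis
qed

text \<open>\<open>grad\<close> is a definite description; differentiability supplies existence and
  \<open>GDERIV_unique\<close> uniqueness, so it denotes the actual gradient.\<close>

lemma GDERIV_grad:
  fixes h :: "'a::euclidean_space \<Rightarrow> ereal"
  assumes "(\<lambda>z. real_of_ereal (h z)) differentiable (at x)"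
  shows "GDERIV (\<lambda>z. real_of_ereal (h z)) x :> grad h x"
  unfolding grad_def
  using differentiable_imp_GDERIV[OF assms] by (metis GDERIV_unique theI)

text \<open>Chain rule; it reduces both the subgradient inequality and stationarity to one-variable
  calculus.\<close>

lemma GDERIV_along_line:
  fixes f :: "'a::euclidean_space \<Rightarrow> real"
  assumes "GDERIV f x :> g"
  shows "((\<lambda>t. f (x + t *\<^sub>R v)) has_real_derivative g \<bullet> v) (at 0)"
proof -
  have "((\<lambda>t. x + t *\<^sub>R v) has_derivative (\<lambda>t. t *\<^sub>R v)) (at (0::real))"
    by (auto intro!: derivative_eq_intros)
  moreover have "(f has_derivative (\<lambda>y. y \<bullet> g)) (at (x + 0 *\<^sub>R v))"
    using assms by (simp add: gderiv_def)
  ultimately have "((\<lambda>t. f (x + t *\<^sub>R v)) has_derivative (\<lambda>t. (t *\<^sub>R v) \<bullet> g)) (at 0)"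
    by (rule has_derivative_compose)
  then show ?thesis
    by (simp add: has_field_derivative_def inner_commute mult_commute_abs)
qed

text \<open>Properness rules out one infinite value and the domain the other, so real estimates
  transfer back to \<open>h\<close>.\<close>

lemma edom_eq_ereal:
  assumes "proper h" "x \<in> edom h"
  shows "h x = ereal (real_of_ereal (h x))"
  using assms by (cases "h x") (auto simp: proper_def edom_def)

lemma convex_fun_le:
  fixes h :: "'a::euclidean_space \<Rightarrow> ereal"
  assumes "proper h" "convex_fun h" "x \<in> edom h" "y \<in> edom h" "0 \<le> t" "t \<le> 1"
  shows "h ((1 - t) *\<^sub>R x + t *\<^sub>R y)
    \<le> ereal ((1 - t) * real_of_ereal (h x) + t * real_of_ereal (h y))"
proof -
  have "(x, real_of_ereal (h x)) \<in> epigraph h" "(y, real_of_ereal (h y)) \<in> epigraph h"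
    using edom_eq_ereal[OF assms(1)] assms(3,4) by (auto simp: epigraph_def)
  then have "(1 - t) *\<^sub>R (x, real_of_ereal (h x)) + t *\<^sub>R (y, real_of_ereal (h y)) \<in> epigraph h"
    using assms unfolding convex_fun_def by (intro convexD) auto
  then show ?thesis
    by (simp add: epigraph_def)
qed

lemma convex_edom:
  fixes h :: "'a::euclidean_space \<Rightarrow> ereal"
  assumes "proper h" "convex_fun h"
  shows "convex (edom h)"
  unfolding convex_alt
proof (intro ballI allI impI)
  fix x y and t :: real
  assume "x \<in> edom h" "y \<in> edom h" "0 \<le> t \<and> t \<le> 1"
  then have "h ((1 - t) *\<^sub>R x + t *\<^sub>R y)
    \<le> ereal ((1 - t) * real_of_ereal (h x) + t * real_of_ereal (h y))"
    using convex_fun_le assms by blast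
  then show "(1 - t) *\<^sub>R x + t *\<^sub>R y \<in> edom h"
    by (auto simp: edom_def)
qed

text \<open>By convexity the difference quotients towards \<open>z\<close> are at most
  \<open>h z - h x\<close>, and this bound survives the limit. Outside the domain \<open>h z\<close>
  is infinite and the inequality is trivial.\<close>

lemma grad_in_subdifferential:
  fixes h :: "'a::euclidean_space \<Rightarrow> ereal"
  assumes "proper h" "convex_fun h" "x \<in> edom h"
    and "(\<lambda>z. real_of_ereal (h z)) differentiable (at x)"
  shows "grad h x \<in> subdifferential h x"
  unfolding subdifferential_def
proof (intro CollectI allI)
  fix z
  let ?f = "\<lambda>z. real_of_ereal (h z)"
  show "h x + ereal (grad h x \<bullet> (z - x)) \<le> h z"
  proof (cases "z \<in> edom h")
    case True
    let ?q = "\<lambda>t. (?f (x + t *\<^sub>R (z - x)) - ?f x) / t"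
    have "((\<lambda>t. ?f (x + t *\<^sub>R (z - x))) has_real_derivative grad h x \<bullet> (z - x)) (at 0)"
      using assms(4) by (intro GDERIV_along_line GDERIV_grad)
    then have "(?q \<longlongrightarrow> grad h x \<bullet> (z - x)) (at 0)"
      by (simp add: DERIV_def)
    \<comment> \<open>The convexity bound covers only positive \<open>t\<close>, so the limit is
      taken from the right.\<close>
    then have lim: "(?q \<longlongrightarrow> grad h x \<bullet> (z - x)) (at_right 0)"
      by (rule filterlim_mono) (auto intro: at_le)
    have le: "?q t \<le> ?f z - ?f x" if t: "0 < t" "t < 1" for t
    proof -
      have eq: "x + t *\<^sub>R (z - x) = (1 - t) *\<^sub>R x + t *\<^sub>R z"
        by (simp add: algebra_simps)
      \<comment> \<open>Finiteness at this point turns the extended-valued convexity bound into one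
        for \<open>?f\<close>.\<close>
      have "(1 - t) *\<^sub>R x + t *\<^sub>R z \<in> edom h"
        using convexD_alt[OF convex_edom[OF assms(1,2)] assms(3) True] t by simp
      then have "?f (x + t *\<^sub>R (z - x)) \<le> (1 - t) * ?f x + t * ?f z"
        using convex_fun_le[OF assms(1-3) True, of t] t
          edom_eq_ereal[OF assms(1), of "(1 - t) *\<^sub>R x + t *\<^sub>R z"]
        unfolding eq by (metis ereal_less_eq(3) less_imp_le)
      then show ?thesis
        using t by (simp add: field_simps)
    qed
    have "\<forall>\<^sub>F t in at_right 0. ?q t \<le> ?f z - ?f x"
      using le by (auto simp: eventually_at_right_field intro!: exI[of _ 1])
    then have "grad h x \<bullet> (z - x) \<le> ?f z - ?f x"
      using lim by (intro tendsto_upperbound) auto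
    then have "ereal (?f x) + ereal (grad h x \<bullet> (z - x)) \<le> ereal (?f z)"
      by simp
    then show ?thesis
      using edom_eq_ereal[OF assms(1) assms(3)] edom_eq_ereal[OF assms(1) True] by metis
  qed (simp add: edom_def)
qed

text \<open>Essential strict convexity concerns convex sets on which subgradients exist; the
  interior of the domain is one, with the gradient as witness.\<close>

lemma legendre_strictly_convex_interior:
  fixes h :: "'a::euclidean_space \<Rightarrow> ereal"
  assumes "legendre h"
  shows "strictly_convex_fun_on (interior (edom h)) h"
proof -
  have "interior (edom h) \<subseteq> {x. subdifferential h x \<noteq> {}}"
    using assms grad_in_subdifferential interior_subset
    unfolding legendre_def essentially_smooth_def by blast
  then show ?thesis
    using assms convex_edom convex_interior
    unfolding legendre_def essentially_strictly_convex_def by blast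
qed

text \<open>The strict bound at weight 1/2 is the average of two finite values, hence at most the
  larger one.\<close>

lemma strictly_convex_midpoint_less:
  fixes h :: "'a::euclidean_space \<Rightarrow> ereal"
  assumes "proper h" "strictly_convex_fun_on C h" "C \<subseteq> edom h"
    and "x \<in> C" "y \<in> C" "x \<noteq> y" "h x \<le> h y"
  shows "h (midpoint x y) < h y"
proof -
  have "h (midpoint x y) = h ((1 - 1/2) *\<^sub>R x + (1/2::real) *\<^sub>R y)"
    by (simp add: midpoint_def algebra_simps)
  also have "\<dots> < ereal (1 - 1/2) * h x + ereal (1/2) * h y"
    using assms(2)[unfolded strictly_convex_fun_on_def, rule_format, of x y "1/2"] assms(4-6)
    by simp
  also have "\<dots> \<le> h y"
    using assms edom_eq_ereal[OF assms(1), of x] edom_eq_ereal[OF assms(1), of y]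
    by (cases "h x"; cases "h y") auto
  finally show ?thesis .
qed

text \<open>The midpoint of two distinct minimizers would stay in \<open>C\<close> and have a
  smaller value. This serves both for the affine hull and for the whole interior of the
  domain.\<close>

lemma legendre_unique_arg_min:
  fixes h :: "'a::euclidean_space \<Rightarrow> ereal"
  assumes "legendre h" "convex C" "C \<subseteq> interior (edom h)"
    and "x \<in> C" "y \<in> C" "\<And>z. z \<in> C \<Longrightarrow> h x \<le> h z" "h y \<le> h x"
  shows "y = x"
proof (rule ccontr)
  assume "y \<noteq> x"
  then have "h (midpoint y x) < h x"
    using strictly_convex_midpoint_less[of h "interior (edom h)" y x]
      legendre_strictly_convex_interior[OF assms(1)] assms interior_subset
    by (auto simp: legendre_def)
  moreover have "midpoint y x \<in> C"
    using assms(2,4,5) by (meson convex_contains_segment midpoint_in_closed_segment subsetD)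
  ultimately show False
    using assms(6) by (simp add: leD)
qed

text \<open>An affine set contains the whole line through \<open>c\<close> and \<open>x\<close>, so
  \<open>c\<close> is a two-sided minimum along it and the derivative in direction
  \<open>x - c\<close> vanishes.\<close>

lemma GDERIV_zero_at_affine_minimum:
  fixes f :: "'a::euclidean_space \<Rightarrow> real"
  assumes "GDERIV f c :> g" "affine A" "c \<in> A" "x \<in> A"
    and min: "\<And>y. y \<in> A \<Longrightarrow> f c \<le> f y"
  shows "g \<bullet> x = g \<bullet> c"
proof -
  have "c + t *\<^sub>R (x - c) \<in> A" for t
    using mem_affine[OF assms(2,3,4), of "1 - t" t] by (simp add: algebra_simps)
  then have "f (c + 0 *\<^sub>R (x - c)) \<le> f (c + t *\<^sub>R (x - c))" for t
    using min by simp
  then have "g \<bullet> (x - c) = 0"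
    by (intro DERIV_local_min[OF GDERIV_along_line[OF assms(1)] zero_less_one]) blast
  then show ?thesis
    by (simp add: inner_diff_right)
qed

theorem lemma10p1:
  fixes h :: "real ^ 'n \<Rightarrow> ereal"
    and K :: "(real ^ 'n) set"
    and u :: "nat \<Rightarrow> real ^ 'n"
    and p :: nat
    and c :: "real ^ 'n"
    and \<kappa> :: real
  assumes "legendre h"
    and "0 \<in> interior (edom h)"
    and "grad h 0 = 0"
    and "polyhedral_cone K"
    and "normalized_conic_base K = u ` {1..p}"
    and "K = convex_cone hull (normalized_conic_base K)"
    and "affine hull (normalized_conic_base K) \<subseteq> interior (edom h)"
    and "0 \<notin> affine hull (normalized_conic_base K)"
    and "is_arg_min (\<lambda>x. bregman h x 0) (\<lambda>x. x \<in> affine hull (normalized_conic_base K)) c"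
    and "\<kappa> = grad h c \<bullet> c"
  shows "(\<forall>c'. is_arg_min (\<lambda>x. bregman h x 0)
               (\<lambda>x. x \<in> affine hull (normalized_conic_base K)) c' \<longrightarrow> c' = c) \<and>
         c \<noteq> 0 \<and> \<kappa> > 0 \<and> (\<forall>i\<in>{1..p}. grad h c \<bullet> u i = \<kappa>)"
proof -
  define A where "A = affine hull (normalized_conic_base K)"
  let ?I = "interior (edom h)"
  let ?f = "\<lambda>z. real_of_ereal (h z)"
  have h: "proper h" "convex_fun h"
    using assms(1) by (auto simp: legendre_def)
  have fin: "h z = ereal (?f z)" if "z \<in> ?I" for z
    using that edom_eq_ereal[OF h(1)] interior_subset by blast
  have A: "affine A" "A \<subseteq> ?I" "0 \<notin> A"
    using assms(7,8) by (auto simp: A_def)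
  have diff: "?f differentiable (at z)" if "z \<in> ?I" for z
    using that assms(1) by (auto simp: legendre_def essentially_smooth_def)
  have subgrad: "h z + ereal (grad h z \<bullet> (y - z)) \<le> h y" if "z \<in> ?I" for y z
  proof -
    have "z \<in> edom h"
      using that interior_subset by blast
    then have "grad h z \<in> subdifferential h z"
      using grad_in_subdifferential[OF h _ diff[OF that]] by blast
    then show ?thesis
      by (simp add: subdifferential_def)
  qed
  have breg: "bregman h z 0 = ereal (?f z - ?f 0)" if "z \<in> A" for z
    using fin[OF assms(2)] fin[of z] that A(2) assms(3)
    unfolding bregman_def by (metis diff_zero ereal_minus(1) inner_zero_left subsetD)
  \<comment> \<open>On \<open>A\<close> the divergence and \<open>?f\<close> differ by the constant
    \<open>?f 0\<close>, so they have the same minimizers there.\<close>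
  have arg_min: "is_arg_min (\<lambda>x. bregman h x 0) (\<lambda>x. x \<in> A) z \<longleftrightarrow>
      z \<in> A \<and> (\<forall>y\<in>A. ?f z \<le> ?f y)" for z
    by (auto simp: is_arg_min_linorder breg)
  have c: "c \<in> A" "\<And>y. y \<in> A \<Longrightarrow> ?f c \<le> ?f y"
    using assms(9) arg_min by (auto simp: A_def)
  have cI: "c \<in> ?I"
    using c A by blast
  have unique: "c' = c" if "is_arg_min (\<lambda>x. bregman h x 0) (\<lambda>x. x \<in> A) c'" for c'
  proof (rule legendre_unique_arg_min[OF assms(1) _ A(2) c(1)])
    show "convex A"
      using A(1) by (rule affine_imp_convex)
    show "c' \<in> A"
      using that arg_min by blast
    show "h c \<le> h z" if "z \<in> A" for z
      using c(2)[OF that] fin[OF cI] fin[of z] that A(2)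
      by (metis ereal_less_eq(3) subsetD)
    have "?f c' \<le> ?f c"
      using that arg_min c(1) by blast
    then show "h c' \<le> h c"
      using fin[OF cI] fin[of c'] \<open>c' \<in> A\<close> A(2)
      by (metis ereal_less_eq(3) subsetD)
  qed
  have c0: "c \<noteq> 0"
    using c A by blast
  have "\<not> h c \<le> h 0"
  proof
    assume "h c \<le> h 0"
    \<comment> \<open>The gradient at \<open>0\<close> vanishes, so its subgradient inequality makes
      \<open>0\<close> a global minimizer; \<open>c\<close> would then be a second one over the
      interior.\<close>
    moreover have "h 0 \<le> h z" for z
      using subgrad[OF assms(2), of z] assms(3) by (simp flip: zero_ereal_def)
    moreover have "convex ?I"
      using convex_edom[OF h] by (rule convex_interior)
    ultimately have "c = 0"
      using legendre_unique_arg_min[OF assms(1), of ?I 0 c] assms(2) cI by blast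
    then show False
      using c0 by blast
  qed
  then have "?f 0 < ?f c"
    using fin[OF cI] fin[OF assms(2)] by (metis ereal_less_eq(3) not_le)
  \<comment> \<open>The subgradient inequality at \<open>c\<close> is tested at \<open>0\<close>,
    where the linear term is \<open>- \<kappa>\<close>; so \<kappa> is at least the positive gap
    \<open>?f c - ?f 0\<close>.\<close>
  moreover have "?f c - grad h c \<bullet> c \<le> ?f 0"
  proof -
    have "ereal (?f c) + ereal (grad h c \<bullet> (0 - c)) \<le> ereal (?f 0)"
      using subgrad[OF cI, of 0] fin[OF cI] fin[OF assms(2)] by metis
    then show ?thesis
      by simp
  qed
  ultimately have "\<kappa> > 0"
    using assms(10) by linarith
  moreover have "grad h c \<bullet> u i = \<kappa>" if "i \<in> {1..p}" for i
  proof -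
    \<comment> \<open>Base vectors lie in their affine hull, where \<open>grad h c\<close> has the
      same inner product with every point as with \<open>c\<close>.\<close>
    have "u i \<in> A"
      using that assms(5) unfolding A_def by (intro hull_inc) auto
    then show ?thesis
      using GDERIV_zero_at_affine_minimum[OF GDERIV_grad[OF diff[OF cI]] A(1) c(1) _ c(2)] assms(10)
      by blast
  qed
  ultimately show ?thesis
    using unique c0 unfolding A_def by blast
qed

end
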